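(* Let $Y$ be a hyperfinite set with $|Y|=M$ infinite, let $(Y,P_L(Y),\mu_L)$ be its Loeb space, and let $T:Y\to Y$ be an internal permutation. Then for every $S$-integrable function $F:Y\to{}^*\mathbb{R}$ there exists an infinite hypernatural number $N$ such that for $\mu_L$-almost every $x\in Y$ the following holds: for all infinite hypernatural numbers $L<N$ one has $A_L(F,T,x)\approx A_N(F,T,x)$.
   Context: We work in an $\aleph_1$-saturated nonstandard universe. $\alpha\approx\beta$ means that $\alpha-\beta$ is infinitesimal; an infinite hypernatural number is an element of ${}^*\mathbb{N}\setminus\mathbb{N}$. For $Y$ hyperfinite with internal cardinality $M$, the Loeb space $(Y,P_L(Y),\mu_L)$ is the completion of the $\sigma$-additive extension (to the $\sigma$-algebra generated by the internal subsets of $Y$) of the finitely additive measure $\mu(B)={}^\circ(|B|/M)$, $B\subseteq Y$ internal, where ${}^\circ$ denotes the standard part. An internal function $F:Y\to{}^*\mathbb{R}$ is $S$-integrable if for every infinite $K\in{}^*\mathbb{N}$ one has $\frac1M\sum_{\{y\in Y:\ |F(y)|>K\}}|F(y)|\approx 0$. For $k\in{}^*\mathbb{N}$, $k\ge 1$, $A_k(F,T,x)=\frac1k\sum_{i=0}^{k-1}F(T^ix)$. *)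

theory Defs
  imports "HOL-Analysis.Analysis"
begin

text \<open>
  The standard universe consists of the reals, the points of an arbitrary type (which may
  itself be a type of sets, functions, etc.), and the sets of points, the maps on points and the
  real functions on points.  A nonstandard universe is a type \<open>'s\<close> of internal objects
  with a map \<open>star\<close> that assigns to every standard relation (a set of argument lists,
  of any arity) its nonstandard extension.  A nonstandard universe over a superstructure \<open>V(X)\<close>
  yields such a map when the points are taken to be the elements of a level \<open>V\<^sub>n(X)\<close>
  and everything is restricted to the sorts below.
\<close>

datatype 'a obj =
    RealO real
  | PointO 'a
  | SetO "'a set"
  | MapO "'a \<Rightarrow> 'a"
  | FunO "'a \<Rightarrow> real"

type_synonym ('a, 's) star_map = "'a obj list set \<Rightarrow> 's list set"


subsection \<open>Transfer and saturation\<close>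

text \<open>First-order formulas with equality and a relation symbol for every standard relation;
  constants are singleton relations, sets are unary relations.\<close>

datatype 'u fm =
    Rel "'u list set" "nat list"
  | Eq nat nat
  | Neg "'u fm"
  | Conj "'u fm" "'u fm"
  | Ex nat "'u fm"

primrec holds :: "('u list set \<Rightarrow> 'x list set) \<Rightarrow> (nat \<Rightarrow> 'x) \<Rightarrow> 'u fm \<Rightarrow> bool" where
  "holds I e (Rel R vs) \<longleftrightarrow> map e vs \<in> I R"
| "holds I e (Eq v w) \<longleftrightarrow> e v = e w"
| "holds I e (Neg \<phi>) \<longleftrightarrow> \<not> holds I e \<phi>"
| "holds I e (Conj \<phi> \<psi>) \<longleftrightarrow> holds I e \<phi> \<and> holds I e \<psi>"
| "holds I e (Ex v \<phi>) \<longleftrightarrow> (\<exists>x. holds I (e(v := x)) \<phi>)"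

text \<open>Quantifying over all assignments amounts to taking universal closures, so this is transfer
  for all sentences.\<close>

definition transfer_principle :: "('a, 's) star_map \<Rightarrow> bool" where
  "transfer_principle star \<longleftrightarrow>
     (\<forall>\<phi>. (\<forall>e. holds (\<lambda>R. R) e \<phi>) \<longleftrightarrow> (\<forall>e. holds star e \<phi>))"

text \<open>A set is internal iff it is a member of the extension of a standard family of sets.  Here
  the standard family is \<open>{x. x # p \<in> R}\<close>, indexed by \<open>p\<close>, and the internal
  parameters \<open>p\<close> select the member of its extension.\<close>

definition internal_set :: "('a, 's) star_map \<Rightarrow> 's set \<Rightarrow> bool" where
  "internal_set star A \<longleftrightarrow> (\<exists>R p. A = {x. x # p \<in> star R})"

definition aleph1_saturated :: "('a, 's) star_map \<Rightarrow> bool" where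
  "aleph1_saturated star \<longleftrightarrow>
     (\<forall>A :: nat \<Rightarrow> 's set. (\<forall>n. internal_set star (A n)) \<and> (\<forall>n. (\<Inter>i\<le>n. A i) \<noteq> {})
        \<longrightarrow> (\<Inter>i. A i) \<noteq> {})"

definition saturated_nonstandard_universe :: "('a, 's) star_map \<Rightarrow> bool" where
  "saturated_nonstandard_universe star \<longleftrightarrow> transfer_principle star \<and> aleph1_saturated star"


subsection \<open>Hyperreals and hypernaturals\<close>

text \<open>The value at internal arguments of the extension of a standard (partial) function given by
  its graph.  By transfer it is uniquely determined at all arguments in the extension of the
  domain.\<close>

definition star_val :: "('a, 's) star_map \<Rightarrow> 'a obj list set \<Rightarrow> 's list \<Rightarrow> 's" where
  "star_val star G xs = (THE y. xs @ [y] \<in> star G)"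

definition hreal_of :: "('a, 's) star_map \<Rightarrow> real \<Rightarrow> 's" where
  "hreal_of star r = star_val star {[RealO r]} []"

definition hreals :: "('a, 's) star_map \<Rightarrow> 's set" where
  "hreals star = {x. [x] \<in> star {[RealO r] | r. True}}"

definition hnats :: "('a, 's) star_map \<Rightarrow> 's set" where
  "hnats star = {x. [x] \<in> star {[RealO (real n)] | n. True}}"

definition infinite_hnat :: "('a, 's) star_map \<Rightarrow> 's \<Rightarrow> bool" where
  "infinite_hnat star N \<longleftrightarrow> N \<in> hnats star - range (\<lambda>n. hreal_of star (real n))"

definition hless :: "('a, 's) star_map \<Rightarrow> 's \<Rightarrow> 's \<Rightarrow> bool" where
  "hless star x y \<longleftrightarrow> [x, y] \<in> star {[RealO a, RealO b] | a b. a < b}"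

definition hminus :: "('a, 's) star_map \<Rightarrow> 's \<Rightarrow> 's \<Rightarrow> 's" where
  "hminus star x y = star_val star {[RealO a, RealO b, RealO (a - b)] | a b. True} [x, y]"

definition hdivide :: "('a, 's) star_map \<Rightarrow> 's \<Rightarrow> 's \<Rightarrow> 's" where
  "hdivide star x y = star_val star {[RealO a, RealO b, RealO (a / b)] | a b. True} [x, y]"

definition habs :: "('a, 's) star_map \<Rightarrow> 's \<Rightarrow> 's" where
  "habs star x = star_val star {[RealO a, RealO \<bar>a\<bar>] | a. True} [x]"

definition infinitesimal :: "('a, 's) star_map \<Rightarrow> 's \<Rightarrow> bool" where
  "infinitesimal star x \<longleftrightarrow>
     x \<in> hreals star \<and> (\<forall>\<epsilon>::real. \<epsilon> > 0 \<longrightarrow> hless star (habs star x) (hreal_of star \<epsilon>))"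

definition infinitely_close :: "('a, 's) star_map \<Rightarrow> 's \<Rightarrow> 's \<Rightarrow> bool" where
  "infinitely_close star x y \<longleftrightarrow>
     x \<in> hreals star \<and> y \<in> hreals star \<and> infinitesimal star (hminus star x y)"

definition standard_part :: "('a, 's) star_map \<Rightarrow> 's \<Rightarrow> real" where
  "standard_part star x = (THE r. infinitely_close star x (hreal_of star r))"


subsection \<open>Hyperfinite sets and Loeb spaces\<close>

definition elements :: "('a, 's) star_map \<Rightarrow> 's \<Rightarrow> 's set" where
  "elements star B = {x. [x, B] \<in> star {[PointO a, SetO A] | a A. a \<in> A}}"

definition internal_point_sets :: "('a, 's) star_map \<Rightarrow> 's set" where
  "internal_point_sets star = {B. [B] \<in> star {[SetO A] | A. True}}"

definition hyperfinite :: "('a, 's) star_map \<Rightarrow> 's \<Rightarrow> bool" where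
  "hyperfinite star B \<longleftrightarrow> [B] \<in> star {[SetO A] | A. finite A}"

definition hcard :: "('a, 's) star_map \<Rightarrow> 's \<Rightarrow> 's" where
  "hcard star B = star_val star {[SetO A, RealO (real (card A))] | A. finite A} [B]"

text \<open>The generating sets are indexed by the internal objects that code them.  A sigma-additive
  extension to the generated sigma-algebra exists by saturation and is unique, so
  \<^const>\<open>extend_measure\<close> denotes it.\<close>

definition loeb :: "('a, 's) star_map \<Rightarrow> 's \<Rightarrow> 's measure" where
  "loeb star Y = completion (extend_measure (elements star Y)
     {B \<in> internal_point_sets star. elements star B \<subseteq> elements star Y}
     (elements star)
     (\<lambda>B. ennreal (standard_part star (hdivide star (hcard star B) (hcard star Y)))))"


subsection \<open>Internal maps, S-integrability, ergodic averages\<close>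

text \<open>Maps and functions on points are total, only their restriction to \<open>Y\<close> is used.
  Every internal function on \<open>Y\<close> is such a restriction.\<close>

definition internal_permutation :: "('a, 's) star_map \<Rightarrow> 's \<Rightarrow> 's \<Rightarrow> bool" where
  "internal_permutation star Y T \<longleftrightarrow> [T, Y] \<in> star {[MapO t, SetO A] | t A. bij_betw t A A}"

definition internal_function :: "('a, 's) star_map \<Rightarrow> 's \<Rightarrow> bool" where
  "internal_function star F \<longleftrightarrow> [F] \<in> star {[FunO f] | f. True}"

definition tail_mean :: "'a set \<Rightarrow> ('a \<Rightarrow> real) \<Rightarrow> real \<Rightarrow> real" where
  "tail_mean A f k = (1 / real (card A)) * (\<Sum>y \<in> {y \<in> A. \<bar>f y\<bar> > k}. \<bar>f y\<bar>)"

definition S_integrable :: "('a, 's) star_map \<Rightarrow> 's \<Rightarrow> 's \<Rightarrow> bool" where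
  "S_integrable star Y F \<longleftrightarrow> internal_function star F \<and>
     (\<forall>K. infinite_hnat star K \<longrightarrow>
        infinitely_close star
          (star_val star {[SetO A, FunO f, RealO k, RealO (tail_mean A f k)] | A f k. finite A}
            [Y, F, K])
          (hreal_of star 0))"

definition time_average :: "('a \<Rightarrow> real) \<Rightarrow> ('a \<Rightarrow> 'a) \<Rightarrow> nat \<Rightarrow> 'a \<Rightarrow> real" where
  "time_average f t k x = (1 / real k) * (\<Sum>i<k. f ((t ^^ i) x))"

definition haverage :: "('a, 's) star_map \<Rightarrow> 's \<Rightarrow> 's \<Rightarrow> 's \<Rightarrow> 's \<Rightarrow> 's" where
  "haverage star k F T x = star_val star
     {[RealO (real n), FunO f, MapO t, PointO a, RealO (time_average f t n a)] | n f t a. n \<ge> 1}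
     [k, F, T, x]"

end

theory Submission
  imports Defs
begin

text \<open>
  Fix a hyperfinite system \<open>(Y, T)\<close> and an S-integrable \<open>F\<close>.  The core of the theorem is a claim about
  standard times: for every \<open>\<epsilon> > 0\<close> there is a standard \<open>n\<close> such that for all standard \<open>m\<close> the set of
  points at which some average \<open>A\<^sub>k\<close> with \<open>n \<le> k \<le> m\<close> differs from \<open>A\<^sub>n\<close> by more than \<open>\<epsilon>\<close> has at
  most \<open>\<epsilon> |Y|\<close> elements (\<open>fluctuations_stabilize\<close>).  Take \<open>\<epsilon> = 2\<^sup>-\<^sup>j\<close> with \<open>n = \<nu> j\<close>.  Saturation gives
  one infinite \<open>N\<close> that can replace \<open>m\<close> for all \<open>j\<close> simultaneously.  The exceptional sets are then
  internal of Loeb measure at most \<open>2\<^sup>-\<^sup>j\<close>, so by Borel-Cantelli almost every point lies in only finitely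
  many of them.  At such a point, for all large \<open>j\<close>, both \<open>A\<^sub>L\<close> and \<open>A\<^sub>N\<close> are within \<open>2\<^sup>-\<^sup>j\<close> of the
  average at time \<open>\<nu> j\<close>, whenever \<open>L < N\<close> is infinite.

  No bound on \<open>n\<close> in the claim can be uniform over all finite systems, because the ergodic theorem has no
  rate of convergence.  What is uniform is its metastable form (\<open>metastable_ergodic_theorem\<close>): for
  every \<open>\<Phi>\<close> there is a \<open>B\<close> such that every finite system with controlled tails has an \<open>n \<le> B\<close> that is
  good for \<open>m = \<Phi> n\<close>.  If the claim failed, a bad \<open>m\<close> for each standard \<open>n\<close> would define a standard
  function \<open>\<Phi>\<close>, and the transfer of the metastable theorem for this \<open>\<Phi>\<close> is a contradiction.  Thus
  all ergodic theory takes place in finite standard systems, and only single relations between the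
  internal objects have to be transferred.

  The metastable theorem combines two facts.  If \<open>A\<^sub>n f\<close> is close in mean square to \<open>A\<^sub>r A\<^sub>n f\<close> for an
  \<open>r\<close> far beyond \<open>m\<close>, then the almost invariance of long averages and the maximal ergodic inequality
  make the averages up to time \<open>m\<close> stable outside a small set.  Otherwise, by the parallelogram identity, the
  energy \<open>\<Sum> (A\<^sub>q f)\<^sup>2\<close> at a later time \<open>q\<close> is smaller by a fixed proportion of \<open>|A|\<close>, which
  can happen only boundedly often.
\<close>

section \<open>Averages along permutations of finite sets\<close>

text \<open>
  Fluctuation is measured against the average at the initial time \<open>n\<close> and not against a limit: in a finite
  system the limit exists everywhere but is reached at times that depend on the lengths of the cycles.
\<close>

definition fluctuation_set ::
  "'a set \<Rightarrow> ('a \<Rightarrow> real) \<Rightarrow> ('a \<Rightarrow> 'a) \<Rightarrow> real \<Rightarrow> nat \<Rightarrow> nat \<Rightarrow> 'a set" where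
  "fluctuation_set A f t \<epsilon> n m =
     {x \<in> A. \<exists>k. n \<le> k \<and> k \<le> m \<and> \<bar>time_average f t k x - time_average f t n x\<bar> > \<epsilon>}"

lemma sum_funpow_permutation:
  fixes h :: "'a \<Rightarrow> real"
  assumes "bij_betw t A A"
  shows "(\<Sum>x\<in>A. h ((t ^^ i) x)) = (\<Sum>x\<in>A. h x)"
  using bij_betw_funpow[OF assms] by (rule sum.reindex_bij_betw)

text \<open>
  Garsia's argument: let \<open>M\<close> be the maximum of the partial sums of \<open>h - c\<close> up to time \<open>m\<close>, with the empty
  sum included.  On the set \<open>E\<close> where \<open>M > 0\<close> the maximum is attained at a positive time, so
  \<open>M \<le> h - c + M \<circ> t\<close> there.  Summing over \<open>E\<close>, the \<open>M\<close> terms cancel, because \<open>M\<close> is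
  nonnegative, vanishes off \<open>E\<close>, and has the same sum over \<open>A\<close> as \<open>M \<circ> t\<close>.
\<close>

lemma maximal_ergodic_inequality:
  fixes h :: "'a \<Rightarrow> real"
  assumes fin: "finite A" and t: "bij_betw t A A" and h: "\<And>x. h x \<ge> 0"
  shows "c * card {x \<in> A. \<exists>k. 1 \<le> k \<and> k \<le> m \<and> time_average h t k x > c} \<le> (\<Sum>x\<in>A. h x)"
proof -
  define S where "S k x = (\<Sum>i<k. h ((t ^^ i) x) - c)" for k x
  define M where "M x = Max ((\<lambda>k. S k x) ` {..m})" for x
  define E where "E = {x \<in> A. \<exists>k. 1 \<le> k \<and> k \<le> m \<and> time_average h t k x > c}"
  have fE: "finite E" and EA: "E \<subseteq> A" using fin by (auto simp: E_def)
  have M_ge: "S k x \<le> M x" if "k \<le> m" for k x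
    unfolding M_def using that by (intro Max_ge) auto
  have M_nonneg: "M x \<ge> 0" for x using M_ge[of 0 x] by (simp add: S_def)
  have M_attained: "\<exists>k\<le>m. M x = S k x" for x
  proof -
    have "M x \<in> (\<lambda>k. S k x) ` {..m}" unfolding M_def by (rule Max_in) auto
    thus ?thesis by auto
  qed
  have S_pos: "S k x > 0 \<longleftrightarrow> time_average h t k x > c" if "k \<ge> 1" for k x
    using that by (simp add: S_def time_average_def sum_subtractf field_simps)
  have M_step: "M x \<le> h x - c + M (t x)" if "x \<in> E" for x
  proof -
    have pos: "M x > 0"
    proof -
      obtain k where "1 \<le> k" "k \<le> m" "time_average h t k x > c" using \<open>x \<in> E\<close> by (auto simp: E_def)
      thus ?thesis using S_pos[of k x] M_ge[of k x] by linarith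
    qed
    obtain k where k: "k \<le> m" "M x = S k x" using M_attained by blast
    then obtain l where l: "k = Suc l" using pos by (cases k) (auto simp: S_def)
    have "S k x = h x - c + S l (t x)"
      unfolding S_def l by (subst sum.lessThan_Suc_shift) (simp add: funpow_swap1)
    thus ?thesis using M_ge[of l "t x"] k l by simp
  qed
  have M_off: "M x = 0" if "x \<in> A - E" for x
  proof -
    obtain k where k: "k \<le> m" "M x = S k x" using M_attained by blast
    show ?thesis
    proof (cases "k \<ge> 1")
      case True
      hence "\<not> S k x > 0" using that k S_pos[of k x] by (auto simp: E_def)
      thus ?thesis using k M_nonneg[of x] by simp
    next
      case False
      hence "k = 0" by simp
      thus ?thesis using k by (simp add: S_def)
    qed
  qed
  have "(\<Sum>x\<in>A. M x) = (\<Sum>x\<in>E. M x)"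
    using M_off EA fin by (intro sum.mono_neutral_right) auto
  also have "\<dots> \<le> (\<Sum>x\<in>E. h x - c + M (t x))" by (intro sum_mono M_step)
  also have "\<dots> = (\<Sum>x\<in>E. h x) - c * card E + (\<Sum>x\<in>E. M (t x))"
    by (simp add: sum.distrib sum_subtractf)
  also have "(\<Sum>x\<in>E. h x) \<le> (\<Sum>x\<in>A. h x)" using fin EA h by (intro sum_mono2) auto
  also have "(\<Sum>x\<in>E. M (t x)) \<le> (\<Sum>x\<in>A. M (t x))" using fin EA M_nonneg by (intro sum_mono2) auto
  also have "(\<Sum>x\<in>A. M (t x)) = (\<Sum>x\<in>A. M x)"
    using sum_funpow_permutation[OF t, of M 1] by simp
  finally show ?thesis by (simp add: E_def)
qed

lemma time_average_diff:
  "time_average (\<lambda>x. f x - g x) t k x = time_average f t k x - time_average g t k x"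
  by (simp add: time_average_def sum_subtractf right_diff_distrib diff_divide_distrib)

lemma abs_time_average_le: "\<bar>time_average f t k x\<bar> \<le> time_average (\<lambda>x. \<bar>f x\<bar>) t k x"
  unfolding time_average_def by (simp add: abs_mult divide_right_mono)

lemma abs_time_average_bound:
  assumes "\<And>i. i < k \<Longrightarrow> \<bar>f ((t ^^ i) x)\<bar> \<le> c" and "c \<ge> 0"
  shows "\<bar>time_average f t k x\<bar> \<le> c"
proof (cases "k = 0")
  case False
  have "\<bar>\<Sum>i<k. f ((t ^^ i) x)\<bar> \<le> (\<Sum>i<k. c)"
    by (rule order_trans[OF sum_abs]) (intro sum_mono, simp add: assms)
  thus ?thesis using False by (simp add: time_average_def field_simps)
qed (simp add: time_average_def assms)

lemma time_average_commute:
  "time_average (time_average f t n) t k x = time_average (time_average f t k) t n x"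
proof -
  have "(\<Sum>i<k. \<Sum>j<n. f ((t ^^ j) ((t ^^ i) x))) = (\<Sum>j<n. \<Sum>i<k. f ((t ^^ i) ((t ^^ j) x)))"
    by (subst sum.swap) (simp add: comp_apply[of "t ^^ _", symmetric] funpow_add[symmetric] add.commute del: o_apply)
  thus ?thesis by (simp add: time_average_def sum_distrib_left[symmetric] sum_divide_distrib[symmetric])
qed

text \<open>
  One step along the orbit exchanges only the two end terms of the sum.
\<close>

lemma time_average_shift:
  assumes "\<And>x. \<bar>f x\<bar> \<le> C"
  shows "\<bar>time_average f t k ((t ^^ l) x) - time_average f t k x\<bar> \<le> 2 * real l * C / real k"
proof (induction l)
  case (Suc l)
  define y where "y = (t ^^ l) x"
  have "(\<Sum>i<k. f ((t ^^ i) (t y))) - (\<Sum>i<k. f ((t ^^ i) y)) = f ((t ^^ k) y) - f y"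
    by (induction k) (auto simp: funpow_swap1)
  hence "time_average f t k (t y) - time_average f t k y = (f ((t ^^ k) y) - f y) / k"
    by (simp add: time_average_def diff_divide_distrib[symmetric])
  moreover have "\<bar>f ((t ^^ k) y) - f y\<bar> \<le> 2 * C"
    using assms[of y] assms[of "(t ^^ k) y"] by linarith
  ultimately have "\<bar>time_average f t k (t y) - time_average f t k y\<bar> \<le> 2 * C / k"
    by (simp add: divide_right_mono)
  thus ?case using Suc.IH by (simp add: y_def algebra_simps add_divide_distrib)
qed simp

text \<open>
  In combination with \<open>time_average_commute\<close> this also says that averaging first over a short time \<open>n\<close>
  hardly changes the average over a long time \<open>k\<close>.
\<close>

lemma long_average_almost_invariant:
  assumes f: "\<And>x. \<bar>f x\<bar> \<le> C" and n: "n \<ge> 1"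
  shows "\<bar>time_average (time_average f t k) t n x - time_average f t k x\<bar> \<le> 2 * real n * C / real k"
proof -
  have C: "C \<ge> 0" using f[of undefined] by linarith
  define v where "v = time_average f t k x"
  have "time_average (\<lambda>y. time_average f t k y - v) t n x = time_average (time_average f t k) t n x - v"
    using n by (simp add: time_average_diff) (simp add: time_average_def)
  moreover have "\<bar>time_average (\<lambda>y. time_average f t k y - v) t n x\<bar> \<le> 2 * real n * C / real k"
  proof (rule abs_time_average_bound)
    fix i assume "i < n"
    have "\<bar>time_average f t k ((t ^^ i) x) - v\<bar> \<le> 2 * real i * C / real k"
      unfolding v_def by (rule time_average_shift[OF f])
    also have "\<dots> \<le> 2 * real n * C / real k"
      using \<open>i < n\<close> C by (intro divide_right_mono mult_right_mono) auto
    finally show "\<bar>time_average f t k ((t ^^ i) x) - v\<bar> \<le> 2 * real n * C / real k" .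
  qed (use C in auto)
  ultimately show ?thesis by (simp add: v_def)
qed

lemma time_average_square_le:
  "(time_average f t k x)\<^sup>2 \<le> time_average (\<lambda>x. (f x)\<^sup>2) t k x"
proof (cases "k = 0")
  case False
  have "(\<Sum>i<k. f ((t ^^ i) x))\<^sup>2 \<le> (\<Sum>i<k. (f ((t ^^ i) x))\<^sup>2) * card {..<k}"
    by (rule sum_squared_le_sum_of_squares) 
  thus ?thesis using False
    by (simp add: time_average_def power_divide field_simps power2_eq_square)
qed (simp add: time_average_def)

lemma sum_time_average:
  assumes "bij_betw t A A" "k \<ge> 1"
  shows "(\<Sum>x\<in>A. time_average f t k x) = (\<Sum>x\<in>A. f x)"
proof -
  have "(\<Sum>x\<in>A. \<Sum>i<k. f ((t ^^ i) x)) = k * (\<Sum>x\<in>A. f x)"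
    by (subst sum.swap) (simp add: sum_funpow_permutation[OF assms(1)])
  thus ?thesis using assms by (simp add: time_average_def sum_divide_distrib[symmetric])
qed

text \<open>
  Convexity of the square, followed by invariance of the sum.
\<close>

lemma energy_time_average_le:
  assumes "bij_betw t A A" "k \<ge> 1"
  shows "(\<Sum>x\<in>A. (time_average f t k x)\<^sup>2) \<le> (\<Sum>x\<in>A. (f x)\<^sup>2)"
  using sum_mono[of A "\<lambda>x. (time_average f t k x)\<^sup>2", OF time_average_square_le]
    sum_time_average[OF assms, of "\<lambda>x. (f x)\<^sup>2"] by simp


section \<open>Metastable convergence of the averages\<close>

lemma ex_nat_quotient_le:
  fixes c e :: real
  assumes "e > 0"
  shows "\<exists>k::nat. k \<ge> 1 \<and> c / real k \<le> e"
proof -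
  obtain k :: nat where k: "c / e < real k" using reals_Archimedean2 by blast
  have "c / real (k + 1) \<le> e"
    using k assms by (simp add: field_simps)
  thus ?thesis by (intro exI[of _ "k + 1"]) simp
qed

text \<open>
  With \<open>g = A\<^sub>n f\<close> and \<open>u = A\<^sub>r g\<close>, the chain \<open>A\<^sub>k f \<approx> A\<^sub>k g \<approx> A\<^sub>k u \<approx> u \<approx> g\<close> holds up to \<open>\<epsilon>\<close> in each
  step, for all \<open>k\<close> between \<open>p\<close> and \<open>m\<close>: the first and third step by almost invariance, as \<open>p\<close> is long
  compared with \<open>n\<close> and \<open>r\<close> is long compared with \<open>m\<close>; the other two by the maximal inequality
  for \<open>(g - u)\<^sup>2\<close>, outside a small set.
\<close>

lemma stable_if_small_increment:
  fixes f :: "'a \<Rightarrow> real" and C \<epsilon> :: real and n p m r :: nat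
  assumes fin: "finite A" and t: "bij_betw t A A" and f: "\<And>x. \<bar>f x\<bar> \<le> C"
    and \<epsilon>: "\<epsilon> > 0" and n: "n \<ge> 1" and p: "p \<ge> 1" "2 * real n * C / real p \<le> \<epsilon>"
    and r: "2 * real m * C / real r \<le> \<epsilon>"
    and small: "(\<Sum>x\<in>A. (time_average f t n x - time_average (time_average f t n) t r x)\<^sup>2)
                  \<le> \<epsilon> ^ 3 * card A"
  shows "card (fluctuation_set A f t (8 * \<epsilon>) p m) \<le> \<epsilon> * card A"
proof -
  define g where "g = time_average f t n"
  define u where "u = time_average g t r"
  define E where "E = {x \<in> A. \<exists>k. 1 \<le> k \<and> k \<le> m \<and> time_average (\<lambda>x. (g x - u x)\<^sup>2) t k x > \<epsilon>\<^sup>2}"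
  have C: "C \<ge> 0" using f[of undefined] by linarith
  have g: "\<bar>g x\<bar> \<le> C" for x unfolding g_def by (rule abs_time_average_bound[OF f C])
  have "\<epsilon>\<^sup>2 * card E \<le> (\<Sum>x\<in>A. (g x - u x)\<^sup>2)"
    unfolding E_def by (rule maximal_ergodic_inequality[OF fin t]) simp
  also have "\<dots> \<le> \<epsilon>\<^sup>2 * (\<epsilon> * card A)"
    using small by (simp add: g_def u_def power3_eq_cube power2_eq_square mult.assoc)
  finally have card_E: "card E \<le> \<epsilon> * card A"
    using \<epsilon> by simp
  have close: "\<bar>time_average f t k x - g x\<bar> \<le> 4 * \<epsilon>"
    if x: "x \<in> A" "x \<notin> E" and k: "p \<le> k" "k \<le> m" for k x
  proof -
    have "\<bar>time_average g t k x - time_average f t k x\<bar> \<le> 2 * real n * C / real k"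
      unfolding g_def time_average_commute[of f t n] by (rule long_average_almost_invariant[OF f n])
    also have "\<dots> \<le> 2 * real n * C / real p"
      using k p C by (intro divide_left_mono) auto
    finally have 1: "\<bar>time_average g t k x - time_average f t k x\<bar> \<le> \<epsilon>" using p by simp
    have dev: "\<bar>time_average g t j x - time_average u t j x\<bar> \<le> \<epsilon>" if j: "1 \<le> j" "j \<le> m" for j
    proof -
      have "(time_average (\<lambda>x. g x - u x) t j x)\<^sup>2 \<le> time_average (\<lambda>x. (g x - u x)\<^sup>2) t j x"
        by (rule time_average_square_le)
      also have "\<dots> \<le> \<epsilon>\<^sup>2" using x j by (auto simp: E_def)
      finally show ?thesis using \<epsilon> by (simp add: time_average_diff abs_le_square_iff[symmetric])
    qed
    have 2: "\<bar>time_average g t k x - time_average u t k x\<bar> \<le> \<epsilon>" using dev k p by simp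
    have 3: "\<bar>g x - u x\<bar> \<le> \<epsilon>" using dev[of 1] k p by (simp add: time_average_def)
    have "\<bar>time_average u t k x - u x\<bar> \<le> 2 * real k * C / real r"
      unfolding u_def using k p by (intro long_average_almost_invariant g) simp
    also have "\<dots> \<le> 2 * real m * C / real r"
      using k C by (intro divide_right_mono mult_right_mono) auto
    finally have 4: "\<bar>time_average u t k x - u x\<bar> \<le> \<epsilon>" using r by simp
    show ?thesis using 1 2 3 4 by linarith
  qed
  have "fluctuation_set A f t (8 * \<epsilon>) p m \<subseteq> E"
  proof
    fix x assume "x \<in> fluctuation_set A f t (8 * \<epsilon>) p m"
    then obtain k where k: "x \<in> A" "p \<le> k" "k \<le> m"
        "\<bar>time_average f t k x - time_average f t p x\<bar> > 8 * \<epsilon>"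
      by (auto simp: fluctuation_set_def)
    show "x \<in> E"
    proof (rule ccontr)
      assume "x \<notin> E"
      thus False using close[of x k] close[of x p] k by auto
    qed
  qed
  hence "card (fluctuation_set A f t (8 * \<epsilon>) p m) \<le> card E"
    by (intro card_mono) (auto simp: E_def fin)
  thus ?thesis using card_E by linarith
qed

text \<open>
  The midpoint \<open>w\<close> of \<open>g = A\<^sub>n f\<close> and \<open>A\<^sub>r g\<close> has by the parallelogram identity less energy than \<open>g\<close>.
  The functions \<open>f\<close>, \<open>g\<close>, \<open>A\<^sub>r g\<close> and hence \<open>w\<close> have almost the same averages over times \<open>q\<close> that are
  long compared with \<open>n + r\<close>, and averaging \<open>w\<close> does not increase the energy.
\<close>

lemma energy_drop_if_large_increment:
  fixes f :: "'a \<Rightarrow> real" and C \<delta> :: real and n r q :: nat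
  assumes t: "bij_betw t A A" and f: "\<And>x. \<bar>f x\<bar> \<le> C"
    and n: "n \<ge> 1" and r: "r \<ge> 1" and q: "q \<ge> 1" "4 * real (n + r) * C\<^sup>2 / real q \<le> \<delta> / 8"
    and large: "(\<Sum>x\<in>A. (time_average f t n x - time_average (time_average f t n) t r x)\<^sup>2) > \<delta> * card A"
  shows "(\<Sum>x\<in>A. (time_average f t q x)\<^sup>2) \<le> (\<Sum>x\<in>A. (time_average f t n x)\<^sup>2) - \<delta> / 8 * card A"
proof -
  define g where "g = time_average f t n"
  define u where "u = time_average g t r"
  define w where "w x = (g x + u x) / 2" for x
  have C: "C \<ge> 0" using f[of undefined] by linarith
  have g: "\<bar>g x\<bar> \<le> C" for x unfolding g_def by (rule abs_time_average_bound[OF f C])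
  have u: "\<bar>u x\<bar> \<le> C" for x unfolding u_def by (rule abs_time_average_bound[OF g C])
  have w: "\<bar>w x\<bar> \<le> C" for x using g[of x] u[of x] by (simp add: w_def)
  have "(w x)\<^sup>2 = (g x)\<^sup>2 / 2 + (u x)\<^sup>2 / 2 - (g x - u x)\<^sup>2 / 4" for x
    by (simp add: w_def power2_eq_square field_simps)
  hence "(\<Sum>x\<in>A. (w x)\<^sup>2) = (\<Sum>x\<in>A. (g x)\<^sup>2) / 2 + (\<Sum>x\<in>A. (u x)\<^sup>2) / 2 - (\<Sum>x\<in>A. (g x - u x)\<^sup>2) / 4"
    by (simp add: sum.distrib sum_subtractf sum_divide_distrib)
  also have "(\<Sum>x\<in>A. (u x)\<^sup>2) \<le> (\<Sum>x\<in>A. (g x)\<^sup>2)"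
    unfolding u_def by (rule energy_time_average_le[OF t r])
  finally have "(\<Sum>x\<in>A. (w x)\<^sup>2) \<le> (\<Sum>x\<in>A. (g x)\<^sup>2) - \<delta> * card A / 4"
    using large by (simp add: g_def u_def)
  moreover have "(\<Sum>x\<in>A. (time_average w t q x)\<^sup>2) \<le> (\<Sum>x\<in>A. (w x)\<^sup>2)"
    by (rule energy_time_average_le[OF t q(1)])
  moreover have "(time_average f t q x)\<^sup>2 \<le> (time_average w t q x)\<^sup>2 + \<delta> / 8" for x
  proof -
    define a b where "a = time_average f t q x" and "b = time_average w t q x"
    have "\<bar>time_average g t q x - a\<bar> \<le> 2 * real n * C / real q"
      unfolding g_def a_def time_average_commute[of f t n] by (rule long_average_almost_invariant[OF f n])
    moreover have "\<bar>time_average u t q x - time_average g t q x\<bar> \<le> 2 * real r * C / real q"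
      unfolding u_def time_average_commute[of g t r] by (rule long_average_almost_invariant[OF g r])
    moreover have "b = (time_average g t q x + time_average u t q x) / 2"
      by (simp add: b_def w_def time_average_def sum.distrib sum_divide_distrib[symmetric] add_divide_distrib)
    moreover have "2 * real r * C / real q \<ge> 0" using C by simp
    moreover have "\<bar>a - b\<bar> \<le> X + Y"
      if "\<bar>v - a\<bar> \<le> X" "\<bar>z - v\<bar> \<le> Y" "b = (v + z) / 2" "Y \<ge> 0" for v z X Y
      using that by (simp add: abs_le_iff field_simps)
    ultimately have "\<bar>a - b\<bar> \<le> 2 * real n * C / real q + 2 * real r * C / real q"
      by blast
    also have "\<dots> = 2 * real (n + r) * C / real q"
      by (simp add: algebra_simps add_divide_distrib)
    finally have ab: "\<bar>a - b\<bar> \<le> 2 * real (n + r) * C / real q" .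
    have "\<bar>a\<bar> \<le> C" "\<bar>b\<bar> \<le> C"
      unfolding a_def b_def by (auto intro: abs_time_average_bound f w C)
    hence "\<bar>a + b\<bar> \<le> 2 * C" by linarith
    have "a\<^sup>2 - b\<^sup>2 = (a - b) * (a + b)" by (simp add: power2_eq_square algebra_simps)
    also have "\<dots> \<le> \<bar>a - b\<bar> * \<bar>a + b\<bar>" by (simp add: abs_mult[symmetric])
    also have "\<dots> \<le> 2 * real (n + r) * C / real q * (2 * C)"
      using ab \<open>\<bar>a + b\<bar> \<le> 2 * C\<close> by (intro mult_mono) auto
    also have "\<dots> = 4 * real (n + r) * C\<^sup>2 / real q" by (simp add: power2_eq_square)
    finally show ?thesis using q(2) by (simp add: a_def b_def)
  qed
  hence "(\<Sum>x\<in>A. (time_average f t q x)\<^sup>2) \<le> (\<Sum>x\<in>A. (time_average w t q x)\<^sup>2 + \<delta> / 8)"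
    by (intro sum_mono)
  hence "(\<Sum>x\<in>A. (time_average f t q x)\<^sup>2) \<le> (\<Sum>x\<in>A. (time_average w t q x)\<^sup>2) + \<delta> / 8 * card A"
    by (simp add: sum.distrib mult.commute)
  ultimately show ?thesis by (simp add: g_def)
qed

text \<open>
  The times \<open>p n\<close>, \<open>r n\<close>, \<open>q n\<close> that make the two preceding lemmas applicable depend only on \<open>n\<close>, \<open>\<epsilon>\<close>, \<open>C\<close>
  and \<open>\<Phi>\<close>, not on the system.  Iterating \<open>q\<close> from time 1, the energy, initially at most \<open>C\<^sup>2 |A|\<close>, cannot
  drop by \<open>\<delta> / 8 |A|\<close> in each of \<open>J\<close> steps once \<open>J \<delta> / 8 > C\<^sup>2\<close>, so some \<open>p n\<close> along the way is stable.
\<close>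

lemma bounded_metastability:
  fixes C \<epsilon> :: real and \<Phi> :: "nat \<Rightarrow> nat"
  assumes \<epsilon>: "\<epsilon> > 0" and C: "C \<ge> 0"
  shows "\<exists>B. \<forall>(A :: 'a set) f t. finite A \<and> bij_betw t A A \<and> (\<forall>x. \<bar>f x\<bar> \<le> C) \<longrightarrow>
           (\<exists>n\<in>{1..B}. card (fluctuation_set A f t (8 * \<epsilon>) n (\<Phi> n)) \<le> \<epsilon> * card A)"
proof -
  define \<delta> where "\<delta> = \<epsilon> ^ 3"
  have \<delta>: "\<delta> > 0" using \<epsilon> by (simp add: \<delta>_def)
  have "\<exists>p. p \<ge> 1 \<and> 2 * real n * C / real p \<le> \<epsilon>" for n
    using ex_nat_quotient_le[OF \<epsilon>] by blast
  then obtain p where p: "\<And>n. p n \<ge> 1" "\<And>n. 2 * real n * C / real (p n) \<le> \<epsilon>" by metis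
  have "\<exists>r. r \<ge> 1 \<and> 2 * real (\<Phi> (p n)) * C / real r \<le> \<epsilon>" for n
    using ex_nat_quotient_le[OF \<epsilon>] by blast
  then obtain r where r: "\<And>n. r n \<ge> 1" "\<And>n. 2 * real (\<Phi> (p n)) * C / real (r n) \<le> \<epsilon>" by metis
  have "\<exists>q. q \<ge> 1 \<and> 4 * real (n + r n) * C\<^sup>2 / real q \<le> \<delta> / 8" for n
    using ex_nat_quotient_le[of "\<delta> / 8"] \<delta> by simp
  then obtain q where q: "\<And>n. q n \<ge> 1" "\<And>n. 4 * real (n + r n) * C\<^sup>2 / real (q n) \<le> \<delta> / 8" by metis
  define s where "s i = (q ^^ i) 1" for i
  have s: "s i \<ge> 1" for i by (cases i) (auto simp: s_def q(1)[simplified])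
  obtain J :: nat where J: "C\<^sup>2 / (\<delta> / 8) < real J" using reals_Archimedean2 by blast
  define B where "B = Max ((\<lambda>i. p (s i)) ` {..<J})"
  show ?thesis
  proof (intro exI[of _ B] allI impI, elim conjE)
    fix A :: "'a set" and f :: "'a \<Rightarrow> real" and t
    assume fin: "finite A" and t: "bij_betw t A A" and "\<forall>x. \<bar>f x\<bar> \<le> C"
    hence f: "\<bar>f x\<bar> \<le> C" for x by blast
    define stable where
      "stable n \<longleftrightarrow> card (fluctuation_set A f t (8 * \<epsilon>) n (\<Phi> n)) \<le> \<epsilon> * card A" for n
    define energy where "energy n = (\<Sum>x\<in>A. (time_average f t n x)\<^sup>2)" for n
    have drop: "stable (p n) \<or> energy (q n) \<le> energy n - \<delta> / 8 * card A" if "n \<ge> 1" for n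
    proof (cases "(\<Sum>x\<in>A. (time_average f t n x - time_average (time_average f t n) t (r n) x)\<^sup>2)
                  \<le> \<delta> * card A")
      case True
      thus ?thesis
        using stable_if_small_increment[where f = f and C = C, OF fin t f \<epsilon> that p r(2)]
        by (simp add: stable_def \<delta>_def)
    next
      case False
      thus ?thesis
        using energy_drop_if_large_increment[where f = f and C = C, OF t f that r(1) q]
        by (simp add: energy_def)
    qed
    have iterate: "(\<exists>i<j. stable (p (s i))) \<or> energy (s j) \<le> (C\<^sup>2 - j * (\<delta> / 8)) * card A" for j
    proof (induction j)
      case 0
      have "energy (s 0) \<le> (\<Sum>x\<in>A. C\<^sup>2)"
        unfolding energy_def using abs_time_average_bound[where f = f, OF f C]
        by (intro sum_mono) (simp add: abs_le_square_iff[symmetric] C)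
      thus ?case by (simp add: mult.commute)
    next
      case (Suc j)
      have "s (Suc j) = q (s j)" by (simp add: s_def)
      show ?case
      proof (cases "\<exists>i<Suc j. stable (p (s i))")
        case False
        hence "\<not> stable (p (s j))" "\<not> (\<exists>i<j. stable (p (s i)))" by auto
        hence "energy (s (Suc j)) \<le> energy (s j) - \<delta> / 8 * card A"
            "energy (s j) \<le> (C\<^sup>2 - j * (\<delta> / 8)) * card A"
          using Suc.IH drop[OF s[of j]] \<open>s (Suc j) = q (s j)\<close> by auto
        thus ?thesis by (simp add: algebra_simps add_divide_distrib)
      qed simp
    qed
    have "\<exists>i<J. stable (p (s i))"
    proof (rule ccontr)
      assume no: "\<not> ?thesis"
      have "card A > 0"
      proof (rule ccontr)
        assume "\<not> card A > 0"
        hence "A = {}" using fin by auto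
        moreover have "0 \<le> C\<^sup>2 / (\<delta> / 8)" using \<delta> by simp
        hence "J > 0" using J by (cases J) auto
        ultimately have "\<exists>i<J. stable (p (s i))"
          by (intro exI[of _ 0] conjI) (auto simp: stable_def fluctuation_set_def)
        thus False using no by blast
      qed
      moreover have "C\<^sup>2 - J * (\<delta> / 8) < 0" using J \<delta> by (simp add: field_simps)
      ultimately have "(C\<^sup>2 - J * (\<delta> / 8)) * card A < 0" by (intro mult_neg_pos) auto
      moreover have "energy (s J) \<le> (C\<^sup>2 - J * (\<delta> / 8)) * card A" using iterate[of J] no by blast
      ultimately have "energy (s J) < 0" by (rule le_less_trans[rotated])
      moreover have "energy (s J) \<ge> 0" unfolding energy_def by (intro sum_nonneg) simp
      ultimately show False by simp
    qed
    then obtain i where i: "i < J" "stable (p (s i))" by blast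
    moreover have "p (s i) \<le> B" unfolding B_def using i by (intro Max_ge) auto
    ultimately show "\<exists>n\<in>{1..B}. card (fluctuation_set A f t (8 * \<epsilon>) n (\<Phi> n)) \<le> \<epsilon> * card A"
      using p(1) by (auto simp: stable_def)
  qed
qed

text \<open>
  Truncation at \<open>K\<close> reduces to bounded functions.  The part cut off has sum at most
  \<open>\<epsilon>\<^sup>2 / 8 |A|\<close>, so by the maximal inequality its averages exceed \<open>\<epsilon> / 4\<close> only on a set of at most
  \<open>\<epsilon> / 2 |A|\<close> points.
\<close>

theorem metastable_ergodic_theorem:
  fixes K \<epsilon> :: real and \<Phi> :: "nat \<Rightarrow> nat"
  assumes \<epsilon>: "\<epsilon> > 0" and K: "K \<ge> 0"
  shows "\<exists>B. \<forall>(A :: 'a set) f t. finite A \<and> bij_betw t A A \<and> tail_mean A f K \<le> \<epsilon>\<^sup>2 / 8 \<longrightarrow>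
           (\<exists>n\<in>{1..B}. card (fluctuation_set A f t \<epsilon> n (\<Phi> n)) \<le> \<epsilon> * card A)"
proof -
  \<comment> \<open>The bounded case is applied with \<open>\<epsilon> / 16\<close>: fluctuations beyond \<open>8 (\<epsilon> / 16) = \<epsilon> / 2\<close> of the truncation,
    plus \<open>\<epsilon> / 4\<close> for the cut-off part at each of the two times, make up \<open>\<epsilon>\<close>.\<close>
  have "\<epsilon> / 16 > 0" using \<epsilon> by simp
  from bounded_metastability[OF this K, of \<Phi>] obtain B where B:
    "\<And>(A :: 'a set) f t. finite A \<Longrightarrow> bij_betw t A A \<Longrightarrow> (\<And>x. \<bar>f x\<bar> \<le> K) \<Longrightarrow>
       (\<exists>n\<in>{1..B}. card (fluctuation_set A f t (8 * (\<epsilon> / 16)) n (\<Phi> n)) \<le> \<epsilon> / 16 * card A)"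
    by metis
  show ?thesis
  proof (intro exI[of _ B] allI impI, elim conjE)
    fix A :: "'a set" and f :: "'a \<Rightarrow> real" and t
    assume fin: "finite A" and t: "bij_betw t A A" and tail: "tail_mean A f K \<le> \<epsilon>\<^sup>2 / 8"
    define f0 where "f0 x = (if \<bar>f x\<bar> \<le> K then f x else 0)" for x
    define h where "h x = (if \<bar>f x\<bar> > K then \<bar>f x\<bar> else 0)" for x
    have f0: "\<bar>f0 x\<bar> \<le> K" for x using K by (simp add: f0_def)
    obtain n where n: "n \<in> {1..B}" and
      stable: "card (fluctuation_set A f0 t (8 * (\<epsilon> / 16)) n (\<Phi> n)) \<le> \<epsilon> / 16 * card A"
      using B[where f = f0, OF fin t f0] by blast
    define E where "E = {x \<in> A. \<exists>k. 1 \<le> k \<and> k \<le> \<Phi> n \<and> time_average h t k x > \<epsilon> / 4}"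
    have "\<epsilon> / 4 * card E \<le> (\<Sum>x\<in>A. h x)"
      unfolding E_def by (rule maximal_ergodic_inequality[OF fin t]) (simp add: h_def)
    also have "\<dots> = card A * tail_mean A f K"
    proof (cases "A = {}")
      case False
      thus ?thesis using fin
        by (simp add: tail_mean_def h_def sum.If_cases Int_def)
    qed simp
    also have "\<dots> \<le> card A * (\<epsilon>\<^sup>2 / 8)" using tail by (intro mult_left_mono) auto
    finally have E: "card E \<le> \<epsilon> / 2 * card A"
      using \<epsilon> by (simp add: power2_eq_square field_simps)
    have diff: "\<bar>time_average f t k x - time_average f0 t k x\<bar> \<le> time_average h t k x" for k x
    proof -
      have "(\<lambda>x. \<bar>f x - f0 x\<bar>) = h" by (auto simp: h_def f0_def)
      thus ?thesis using abs_time_average_le[of "\<lambda>x. f x - f0 x" t k x] by (simp add: time_average_diff)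
    qed
    have "fluctuation_set A f t \<epsilon> n (\<Phi> n) \<subseteq> fluctuation_set A f0 t (8 * (\<epsilon> / 16)) n (\<Phi> n) \<union> E"
    proof
      fix x assume "x \<in> fluctuation_set A f t \<epsilon> n (\<Phi> n)"
      then obtain k where k: "x \<in> A" "n \<le> k" "k \<le> \<Phi> n"
          "\<bar>time_average f t k x - time_average f t n x\<bar> > \<epsilon>"
        by (auto simp: fluctuation_set_def)
      show "x \<in> fluctuation_set A f0 t (8 * (\<epsilon> / 16)) n (\<Phi> n) \<union> E"
      proof (cases "x \<in> E")
        case False
        hence "time_average h t k x \<le> \<epsilon> / 4" "time_average h t n x \<le> \<epsilon> / 4"
          using k n by (auto simp: E_def not_less)
        hence "\<bar>time_average f0 t k x - time_average f0 t n x\<bar> > 8 * (\<epsilon> / 16)"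
          using diff[of k x] diff[of n x] k(4) by linarith
        thus ?thesis using k by (auto simp: fluctuation_set_def)
      qed simp
    qed
    hence "card (fluctuation_set A f t \<epsilon> n (\<Phi> n)) \<le>
             card (fluctuation_set A f0 t (8 * (\<epsilon> / 16)) n (\<Phi> n) \<union> E)"
      by (intro card_mono) (auto simp: fluctuation_set_def E_def fin)
    also have "\<dots> \<le> card (fluctuation_set A f0 t (8 * (\<epsilon> / 16)) n (\<Phi> n)) + card E" by (rule card_Un_le)
    finally have "card (fluctuation_set A f t \<epsilon> n (\<Phi> n)) \<le> \<epsilon> / 16 * card A + \<epsilon> / 2 * card A"
      using stable E by linarith
    also have "\<dots> \<le> \<epsilon> * card A"
      using \<epsilon> by (simp add: distrib_right[symmetric] mult_right_mono)
    finally show "\<exists>n\<in>{1..B}. card (fluctuation_set A f t \<epsilon> n (\<Phi> n)) \<le> \<epsilon> * card A"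
      using n by blast
  qed
qed

section \<open>Transfer without formulas\<close>

context
  fixes star :: "('a, 's) star_map"
  assumes transfer: "transfer_principle star"
begin

lemma transfer_formula:
  assumes "\<And>e. holds (\<lambda>R. R) e \<phi>"
  shows "holds star e \<phi>"
  using transfer assms unfolding transfer_principle_def by blast

lemma holds_conj_list:
  "holds I e (foldr (\<lambda>(R, vs) \<phi>. Conj (Rel R vs) \<phi>) ps (Eq 0 0)) \<longleftrightarrow>
     (\<forall>(R, vs) \<in> set ps. map e vs \<in> I R)"
  by (induction ps) auto

text \<open>
  The working form of transfer.  A clause is a relation together with the indices of its
  arguments in the list \<open>xs\<close> of internal objects; if the clauses in \<open>ps\<close> imply the clause \<open>(S, ws)\<close> for all
  standard objects, they do so for internal ones.  With \<open>S = {}\<close> the conclusion refutes the premises.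
\<close>

lemma transfer_horn:
  assumes "zs = map ((!) xs) ws"
    and "\<And>e. \<forall>(R, vs) \<in> set ps. map e vs \<in> R \<Longrightarrow> map e ws \<in> S"
    and "\<forall>(R, vs) \<in> set ps. map ((!) xs) vs \<in> star R"
  shows "zs \<in> star S"
proof -
  let ?ps = "foldr (\<lambda>(R, vs) \<phi>. Conj (Rel R vs) \<phi>) ps (Eq 0 0)"
  have "holds star ((!) xs) (Neg (Conj ?ps (Neg (Rel S ws))))"
    by (rule transfer_formula) (unfold holds.simps holds_conj_list, use assms(2) in blast)
  thus ?thesis using assms(1,3) by (simp add: holds_conj_list)
qed

lemma transfer_ex:
  assumes "\<And>as. as \<in> R \<Longrightarrow> length as = length xs \<Longrightarrow> \<exists>y. as @ [y] \<in> S"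
    and "xs \<in> star R"
  shows "\<exists>y. xs @ [y] \<in> star S"
proof -
  let ?n = "length xs"
  have upd: "map (e(?n := y)) [0..<?n] = map e [0..<?n]" for e :: "nat \<Rightarrow> 'x" and y
    by (rule map_cong) auto
  have "holds star ((!) xs) (Neg (Conj (Rel R [0..<?n]) (Neg (Ex ?n (Rel S [0..<Suc ?n])))))"
  proof (rule transfer_formula)
    fix e :: "nat \<Rightarrow> 'a obj"
    show "holds (\<lambda>R. R) e (Neg (Conj (Rel R [0..<?n]) (Neg (Ex ?n (Rel S [0..<Suc ?n])))))"
      using assms(1)[of "map e [0..<?n]"] by (auto simp: upd simp del: fun_upd_apply) (auto simp: upd)
  qed
  thus ?thesis using assms(2) by (auto simp: map_nth upd simp del: fun_upd_apply)
qed

lemma star_mono: "xs \<in> star R" if "xs \<in> star S" "\<And>as. as \<in> S \<Longrightarrow> length as = length xs \<Longrightarrow> as \<in> R"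
  by (rule transfer_horn[where xs = xs and ws = "[0..<length xs]" and ps = "[(S, [0..<length xs])]"])
    (use that in \<open>auto simp: map_nth\<close>)

lemma star_empty: "xs \<notin> star {}"
proof -
  have "holds star ((!) xs) (Neg (Rel {} [0..<length xs]))" by (rule transfer_formula) simp
  thus ?thesis by (simp add: map_nth)
qed

lemma star_Compl: "xs \<in> star (- R) \<longleftrightarrow> xs \<notin> star R"
proof -
  have "holds star ((!) xs) (Neg (Conj (Neg (Rel R [0..<length xs])) (Neg (Rel (- R) [0..<length xs]))))"
    by (rule transfer_formula) simp
  moreover have "holds star ((!) xs) (Neg (Conj (Rel R [0..<length xs]) (Rel (- R) [0..<length xs])))"
    by (rule transfer_formula) simp
  ultimately show ?thesis by (auto simp: map_nth)
qed

lemma star_Int: "xs \<in> star (R \<inter> S) \<longleftrightarrow> xs \<in> star R \<and> xs \<in> star S"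
proof
  assume "xs \<in> star R \<and> xs \<in> star S"
  thus "xs \<in> star (R \<inter> S)"
    by (intro transfer_horn[where xs = xs and ws = "[0..<length xs]"
          and ps = "[(R, [0..<length xs]), (S, [0..<length xs])]"]) (auto simp: map_nth)
qed (auto intro: star_mono)

lemma star_disjoint: "R \<inter> S = {} \<Longrightarrow> xs \<in> star R \<Longrightarrow> xs \<notin> star S"
  using star_Int star_empty by metis

lemma star_Un: "xs \<in> star (R \<union> S) \<longleftrightarrow> xs \<in> star R \<or> xs \<in> star S"
proof -
  have "R \<union> S = - (- R \<inter> - S)" by auto
  thus ?thesis by (simp only: star_Compl star_Int) blast
qed

lemma star_finite_UN:
  assumes "finite I" "xs \<in> star (\<Union>i\<in>I. R i)"
  shows "\<exists>i\<in>I. xs \<in> star (R i)"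
  using assms by (induction I) (auto simp: star_empty star_Un)

lemma star_equality: "[x, y] \<in> star (range (\<lambda>a. [a, a])) \<longleftrightarrow> x = y"
proof -
  have "holds star ((!) [x, y]) (Neg (Conj (Rel (range (\<lambda>a. [a, a])) [0, 1]) (Neg (Eq 0 1))))"
    by (rule transfer_formula) auto
  moreover have "holds star ((!) [x, y]) (Neg (Conj (Neg (Rel (range (\<lambda>a. [a, a])) [0, 1])) (Eq 0 1)))"
    by (rule transfer_formula) auto
  ultimately show ?thesis by auto
qed

text \<open>
  The value is a definite description, so the uniqueness of the value has to be transferred before
  anything can be said about it.
\<close>

lemma star_val_eq:
  assumes functional: "\<And>as y y'. length as = length xs \<Longrightarrow> as @ [y] \<in> G \<Longrightarrow> as @ [y'] \<in> G \<Longrightarrow> y = y'"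
    and y: "xs @ [y] \<in> star G"
  shows "star_val star G xs = y"
proof -
  have unique: "z = y" if "xs @ [z] \<in> star G" for z
  proof -
    let ?n = "length xs" and ?zs = "xs @ [z, y]"
    have nth: "map ((!) ?zs) [0..<?n] = xs" by (rule nth_equalityI) (auto simp: nth_append)
    have "[z, y] \<in> star (range (\<lambda>a. [a, a]))"
    proof (rule transfer_horn[where ps = "[(G, [0..<?n] @ [?n]), (G, [0..<?n] @ [Suc ?n])]"
          and xs = ?zs and ws = "[?n, Suc ?n]"])
      fix e :: "nat \<Rightarrow> 'a obj"
      assume "\<forall>(R, vs) \<in> set [(G, [0..<?n] @ [?n]), (G, [0..<?n] @ [Suc ?n])]. map e vs \<in> R"
      hence "e ?n = e (Suc ?n)"
        using functional[of "map e [0..<?n]" "e ?n" "e (Suc ?n)"] by simp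
      thus "map e [?n, Suc ?n] \<in> range (\<lambda>a. [a, a])" by simp
    qed (use that y nth in \<open>simp_all add: nth_append\<close>)
    thus "z = y" by (simp only: star_equality)
  qed
  show ?thesis unfolding star_val_def using y unique by (rule the_equality)
qed

lemma star_val_in:
  assumes functional: "\<And>as y y'. length as = length xs \<Longrightarrow> as @ [y] \<in> G \<Longrightarrow> as @ [y'] \<in> G \<Longrightarrow> y = y'"
    and dom: "\<And>as. as \<in> D \<Longrightarrow> length as = length xs \<Longrightarrow> \<exists>y. as @ [y] \<in> G" and xs: "xs \<in> star D"
  shows "xs @ [star_val star G xs] \<in> star G"
proof -
  obtain y where y: "xs @ [y] \<in> star G" using transfer_ex[OF dom xs] by blast
  thus ?thesis using star_val_eq[OF functional y] by simp
qed

section \<open>Hyperreal and hypernatural numbers\<close>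

lemma hreal_of_in: "[hreal_of star r] \<in> star {[RealO r]}"
proof -
  have "[] \<in> star {[]}" by (rule transfer_horn[where ps = "[]" and ws = "[]"]) auto
  thus ?thesis
    using star_val_in[of "[]" "{[RealO r]}" "{[]}"] by (simp add: hreal_of_def)
qed

lemma eq_hreal_of: "[x] \<in> star {[RealO r]} \<Longrightarrow> x = hreal_of star r"
  using star_val_eq[of "[]" "{[RealO r]}" x] by (simp add: hreal_of_def)

lemma hreal_of_inI: "[RealO r] \<in> R \<Longrightarrow> [hreal_of star r] \<in> star R"
  by (rule star_mono[OF hreal_of_in]) auto

lemma hreal_of_Cons_in_iff:
  assumes "xs \<in> star {as. RealO r # as \<in> R}"
  shows "hreal_of star r # xs \<in> star R"
proof -
  let ?zs = "hreal_of star r # xs" and ?n = "length xs"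
  have nth: "map ((!) ?zs) [Suc 0..<Suc ?n] = xs" 
    unfolding map_Suc_upt[symmetric] map_map comp_def nth_Cons_Suc by (rule map_nth)
  show ?thesis
    by (rule transfer_horn[where ps = "[({[RealO r]}, [0]), ({as. RealO r # as \<in> R}, [Suc 0..<Suc ?n])]"
          and xs = ?zs and ws = "0 # [Suc 0..<Suc ?n]"])
      (use assms hreal_of_in nth in \<open>auto simp del: upt_Suc\<close>)
qed

text \<open>
  This replaces the three internal operations in the definition of closeness by one
  standard relation, which can occur as a clause in transfer.
\<close>

lemma infinitely_close_iff:
  "infinitely_close star x y \<longleftrightarrow> x \<in> hreals star \<and> y \<in> hreals star \<and>
     (\<forall>\<epsilon>>0. [x, y] \<in> star {[RealO a, RealO b] | a b. \<bar>a - b\<bar> < \<epsilon>})"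
proof (cases "x \<in> hreals star \<and> y \<in> hreals star")
  case True
  define w u where "w = hminus star x y" and "u = habs star w"
  have "[x, y] \<in> star {[RealO a, RealO b] | a b. True}"
    by (rule transfer_horn[where ps = "[({[RealO r] | r. True}, [0]), ({[RealO r] | r. True}, [1])]"
          and ws = "[0, 1]" and xs = "[x, y]"]) (use True in \<open>auto simp: hreals_def\<close>)
  hence "[x, y] @ [w] \<in> star {[RealO a, RealO b, RealO (a - b)] | a b. True}"
    unfolding w_def hminus_def by (rule star_val_in[rotated 2]) auto
  hence w: "[x, y, w] \<in> star {[RealO a, RealO b, RealO (a - b)] | a b. True}" by simp
  have w_real: "[w] \<in> star {[RealO r] | r. True}"
    by (rule transfer_horn[where ps = "[({[RealO a, RealO b, RealO (a - b)] | a b. True}, [0, 1, 2])]"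
          and ws = "[2]" and xs = "[x, y, w]"]) (use w in auto)
  hence "[w] @ [u] \<in> star {[RealO a, RealO \<bar>a\<bar>] | a. True}"
    unfolding u_def habs_def by (rule star_val_in[rotated 2]) auto
  hence u: "[w, u] \<in> star {[RealO a, RealO \<bar>a\<bar>] | a. True}" by simp
  have "hless star u (hreal_of star \<epsilon>) \<longleftrightarrow> [x, y] \<in> star {[RealO a, RealO b] | a b. \<bar>a - b\<bar> < \<epsilon>}" for \<epsilon>
  proof
    assume "hless star u (hreal_of star \<epsilon>)"
    thus "[x, y] \<in> star {[RealO a, RealO b] | a b. \<bar>a - b\<bar> < \<epsilon>}"
      by (intro transfer_horn[where ps = "[({[RealO a, RealO b, RealO (a - b)] | a b. True}, [0, 1, 2]),
          ({[RealO a, RealO \<bar>a\<bar>] | a. True}, [2, 3]), ({[RealO a, RealO b] | a b. a < b}, [3, 4]),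
          ({[RealO \<epsilon>]}, [4])]" and ws = "[0, 1]" and xs = "[x, y, w, u, hreal_of star \<epsilon>]"])
        (use w u hreal_of_in[of \<epsilon>] in \<open>auto simp: hless_def\<close>)
  next
    assume "[x, y] \<in> star {[RealO a, RealO b] | a b. \<bar>a - b\<bar> < \<epsilon>}"
    thus "hless star u (hreal_of star \<epsilon>)"
      unfolding hless_def
      by (intro transfer_horn[where ps = "[({[RealO a, RealO b, RealO (a - b)] | a b. True}, [0, 1, 2]),
          ({[RealO a, RealO \<bar>a\<bar>] | a. True}, [2, 3]), ({[RealO a, RealO b] | a b. \<bar>a - b\<bar> < \<epsilon>}, [0, 1]),
          ({[RealO \<epsilon>]}, [4])]" and ws = "[3, 4]" and xs = "[x, y, w, u, hreal_of star \<epsilon>]"])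
        (use w u hreal_of_in[of \<epsilon>] in auto)
  qed
  thus ?thesis using True w_real
    by (auto simp: infinitely_close_def infinitesimal_def w_def u_def hreals_def)
qed (auto simp: infinitely_close_def)

text \<open>
  A bounded hyperreal has a standard part, namely the supremum of the reals below it; without its
  existence the definite description would say nothing.
\<close>

lemma standard_part_le:
  assumes q: "[q] \<in> star {[RealO a] | a. l \<le> a \<and> a \<le> h}"
  shows "standard_part star q \<le> h"
proof -
  define S where "S = {s. [q] \<in> star {[RealO a] | a. s \<le> a}}"
  have "l \<in> S" unfolding S_def mem_Collect_eq by (rule star_mono[OF q]) auto
  have le_h: "s \<le> h" if "s \<in> S" for s
  proof (rule ccontr)
    assume "\<not> s \<le> h"
    hence "{[RealO a] | a. l \<le> a \<and> a \<le> h} \<inter> {[RealO a] | a. s \<le> a} = {}" by auto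
    from star_disjoint[OF this q] show False using that by (simp add: S_def)
  qed
  define r where "r = Sup S"
  have bdd: "bdd_above S" using le_h by (auto simp: bdd_above_def)
  have "r \<le> h" unfolding r_def using \<open>l \<in> S\<close> le_h by (intro cSup_least) auto
  have q_real: "q \<in> hreals star" unfolding hreals_def mem_Collect_eq by (rule star_mono[OF q]) auto
  have hreal: "hreal_of star s \<in> hreals star" for s
    unfolding hreals_def by (auto intro: hreal_of_inI)
  have close: "infinitely_close star q (hreal_of star r)"
    unfolding infinitely_close_iff
  proof (intro conjI allI impI q_real hreal)
    fix \<epsilon> :: real assume \<epsilon>: "\<epsilon> > 0"
    have "r - \<epsilon> < r" using \<epsilon> by simp
    then obtain s where s: "s \<in> S" "s > r - \<epsilon>"
      using less_cSup_iff[of S "r - \<epsilon>"] bdd \<open>l \<in> S\<close> unfolding r_def by blast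
    have "r + \<epsilon> \<notin> S" using cSup_upper[of "r + \<epsilon>" S] bdd \<epsilon> by (auto simp: r_def)
    hence "[q] \<in> star (- {[RealO a] | a. r + \<epsilon> \<le> a})" by (simp add: S_def star_Compl)
    thus "[q, hreal_of star r] \<in> star {[RealO a, RealO b] | a b. \<bar>a - b\<bar> < \<epsilon>}"
      by (intro transfer_horn[where ps = "[({[RealO a] | a. s \<le> a}, [0]), (- {[RealO a] | a. r + \<epsilon> \<le> a}, [0]),
          ({[RealO r]}, [1])]" and ws = "[0, 1]" and xs = "[q, hreal_of star r]"])
        (use s hreal_of_in[of r] in \<open>auto simp: S_def\<close>)
  qed
  moreover have "r' = r" if r': "infinitely_close star q (hreal_of star r')" for r'
  proof (rule ccontr)
    assume "r' \<noteq> r"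
    define \<epsilon> where "\<epsilon> = \<bar>r' - r\<bar> / 2"
    have "\<epsilon> > 0" using \<open>r' \<noteq> r\<close> by (simp add: \<epsilon>_def)
    have far: "\<not> \<bar>a - r'\<bar> < \<epsilon>" if "\<bar>a - r\<bar> < \<epsilon>" for a
    proof -
      have "\<bar>r' - r\<bar> \<le> \<bar>a - r\<bar> + \<bar>a - r'\<bar>" by linarith
      thus ?thesis using that by (simp add: \<epsilon>_def)
    qed
    from \<open>\<epsilon> > 0\<close> have "[q, hreal_of star r] \<in> star {[RealO a, RealO b] | a b. \<bar>a - b\<bar> < \<epsilon>}"
        "[q, hreal_of star r'] \<in> star {[RealO a, RealO b] | a b. \<bar>a - b\<bar> < \<epsilon>}"
      using close r' unfolding infinitely_close_iff by auto
    hence "[] \<in> star {}"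
      using hreal_of_in[of r] hreal_of_in[of r']
      by (intro transfer_horn[where ws = "[]" and xs = "[q, hreal_of star r, hreal_of star r']" and ps = "[({[RealO a, RealO b] | a b. \<bar>a - b\<bar> < \<epsilon>}, [0, 1]),
          ({[RealO a, RealO b] | a b. \<bar>a - b\<bar> < \<epsilon>}, [0, 2]), ({[RealO r]}, [1]), ({[RealO r']}, [2])]"])
        (auto dest: far)
    thus False by (simp add: star_empty)
  qed
  ultimately have "standard_part star q = r" unfolding standard_part_def by (rule the_equality)
  thus ?thesis using \<open>r \<le> h\<close> by simp
qed

text \<open>
  By transfer a hypernatural below the standard \<open>n\<close> is one of \<open>0, \<dots>, n - 1\<close>.
\<close>

lemma infinite_hnat_ge:
  assumes "infinite_hnat star L"
  shows "[L] \<in> star {[RealO (real k)] | k. k \<ge> n}"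
proof -
  have "[L] \<in> star {[RealO (real k)] | k. True}"
    using assms by (auto simp: infinite_hnat_def hnats_def)
  also have "{[RealO (real k)] | k. True} = (\<Union>i\<in>{..<n}. {[RealO (real i)]}) \<union> {[RealO (real k)] | k. k \<ge> n}"
    by (auto simp: not_less[symmetric])
  finally have "[L] \<in> star (\<Union>i\<in>{..<n}. {[RealO (real i)]}) \<or> ?thesis"
    by (simp add: star_Un)
  moreover have "[L] \<notin> star (\<Union>i\<in>{..<n}. {[RealO (real i)]})"
  proof
    assume "[L] \<in> star (\<Union>i\<in>{..<n}. {[RealO (real i)]})"
    then obtain i where "[L] \<in> star {[RealO (real i)]}" using star_finite_UN[of "{..<n}" "[L]"] by blast
    hence "L = hreal_of star (real i)" by (rule eq_hreal_of)
    thus False using assms by (auto simp: infinite_hnat_def)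
  qed
  ultimately show ?thesis by blast
qed

text \<open>
  Countably many internal conditions that hold for every standard number hold for a common infinite one:
  intersecting the \<open>j\<close>-th condition with \<open>K \<ge> j\<close> keeps standard members in all finite intersections and
  forces a common member to be infinite.
\<close>

lemma overspill:
  assumes sat: "aleph1_saturated star"
    and R: "\<And>(j :: nat) k. hreal_of star (real k) # p \<in> star (R j)"
  shows "\<exists>K. infinite_hnat star K \<and> (\<forall>j. K # p \<in> star (R j))"
proof -
  define U where "U j = {RealO (real k) # as | k as. k \<ge> j} \<inter> R j" for j :: nat
  define A where "A j = {x. x # p \<in> star (U j)}" for j
  have "internal_set star (A j)" for j unfolding internal_set_def A_def by blast
  moreover have "(\<Inter>i\<le>n. A i) \<noteq> {}" for n
  proof -
    have "hreal_of star (real n) \<in> A i" if "i \<le> n" for i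
    proof -
      have "p \<in> star UNIV" using star_Compl[of p "{}"] star_empty by simp
      hence "hreal_of star (real n) # p \<in> star {RealO (real k) # as | k as. k \<ge> i}"
        using that by (intro hreal_of_Cons_in_iff) (auto intro: star_mono)
      thus ?thesis using R by (simp add: A_def U_def star_Int)
    qed
    thus ?thesis by blast
  qed
  ultimately have "(\<Inter>i. A i) \<noteq> {}" using sat unfolding aleph1_saturated_def by blast
  then obtain K where K: "\<And>j. K # p \<in> star (U j)" by (auto simp: A_def)
  have ge: "[K] \<in> star {[RealO (real k)] | k. k \<ge> j}" for j
    by (rule transfer_horn[where ps = "[(U j, [0..<Suc (length p)])]" and ws = "[0]" and xs = "K # p"])
      (use K[of j] map_nth[of "K # p"] in \<open>auto simp: U_def upt_conv_Cons simp del: upt_Suc\<close>)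
  have "K \<noteq> hreal_of star (real n)" for n
  proof
    assume "K = hreal_of star (real n)"
    moreover have "{[RealO (real n)]} \<inter> {[RealO (real k)] | k. k \<ge> Suc n} = {}" by auto
    ultimately show False using star_disjoint[OF _ hreal_of_in[of "real n"]] ge[of "Suc n"] by blast
  qed
  moreover have "K \<in> hnats star" using star_mono[OF ge[of 0]] by (auto simp: hnats_def)
  ultimately have "infinite_hnat star K" by (auto simp: infinite_hnat_def)
  moreover have "K # p \<in> star (R j)" for j using K[of j] by (simp add: U_def star_Int)
  ultimately show ?thesis by blast
qed


section \<open>Hyperfinite systems and their Loeb measure\<close>

text \<open>
  S-integrability speaks about infinite truncation levels only; overspill from the finite
  levels, if the tail stayed above \<open>c\<close> at all of them, would produce an infinite level with a large tail.
\<close>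

lemma S_integrable_tail_small:
  assumes sat: "aleph1_saturated star" and Y: "hyperfinite star Y" and F: "S_integrable star Y F"
    and c: "c > 0"
  shows "\<exists>k::nat. [Y, F] \<in> star {[SetO A, FunO f] | A f. tail_mean A f (real k) \<le> c}"
proof (rule ccontr)
  assume none: "\<not> ?thesis"
  define R where "R = {[RealO (real k), SetO A, FunO f] | k (A :: 'a set) f. tail_mean A f (real k) > c}"
  have fin: "[Y] \<in> star {[SetO A] | A. finite A}" using Y by (simp add: hyperfinite_def)
  have fn: "[F] \<in> star {[FunO f] | f. True}"
    using F by (simp add: S_integrable_def internal_function_def)
  have "hreal_of star (real k) # [Y, F] \<in> star R" for k
  proof (rule hreal_of_Cons_in_iff)
    have "[Y, F] \<in> star (- {[SetO A, FunO f] | A f. tail_mean A f (real k) \<le> c})"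
      using none by (simp add: star_Compl)
    thus "[Y, F] \<in> star {as. RealO (real k) # as \<in> R}"
      by (intro transfer_horn[where ps = "[({[SetO A] | A. finite A}, [0]), ({[FunO f] | f. True}, [1]),
            (- {[SetO A, FunO f] | A f. tail_mean A f (real k) \<le> c}, [0, 1])]"
            and ws = "[0, 1]" and xs = "[Y, F]"])
        (use fin fn in \<open>auto simp: R_def not_le\<close>)
  qed
  then obtain K where K: "infinite_hnat star K" "[K, Y, F] \<in> star R"
    using overspill[OF sat, of "[Y, F]" "\<lambda>_. R"] by auto
  define G where "G = {[SetO A, FunO f, RealO k, RealO (tail_mean A f k)] | (A :: 'a set) f k. finite A}"
  define v where "v = star_val star G [Y, F, K]"
  have "[Y, F, K] \<in> star {[SetO A, FunO f, RealO k] | A f k. finite A}"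
    by (rule transfer_horn[where ps = "[({[SetO A] | A. finite A}, [0]), ({[FunO f] | f. True}, [1]),
          ({[RealO (real k)] | k. k \<ge> 0}, [2])]" and ws = "[0, 1, 2]" and xs = "[Y, F, K]"])
      (use fin fn infinite_hnat_ge[OF K(1), of 0] in auto)
  hence "[Y, F, K] @ [v] \<in> star G"
    unfolding v_def by (rule star_val_in[rotated 2]) (auto simp: G_def)
  hence v: "[Y, F, K, v] \<in> star G" by simp
  have "infinitely_close star v (hreal_of star 0)"
    using F K unfolding S_integrable_def v_def G_def by blast
  hence "[v, hreal_of star 0] \<in> star {[RealO a, RealO b] | a b. \<bar>a - b\<bar> < c}"
    using c by (simp add: infinitely_close_iff)
  hence "[] \<in> star {}"
    by (intro transfer_horn[where ps = "[(R, [2, 0, 1]), (G, [0, 1, 2, 3]),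
          ({[RealO a, RealO b] | a b. \<bar>a - b\<bar> < c}, [3, 4]), ({[RealO 0]}, [4])]"
          and ws = "[]" and xs = "[Y, F, K, v, hreal_of star 0]"])
      (use K v hreal_of_in[of 0] in \<open>auto simp: R_def G_def\<close>)
  thus False by (simp add: star_empty)
qed

text \<open>
  The standard time \<open>n\<close> comes from the metastable theorem by contradiction.  The function \<open>\<Phi>\<close> of bad times is chosen outside the nonstandard universe, but it
  is a function on the standard naturals, and only its values at \<open>1, \<dots>, B\<close> enter the relation that is transferred.
\<close>

lemma fluctuations_stabilize:
  fixes \<epsilon> :: real
  assumes Y: "hyperfinite star Y" and T: "internal_permutation star Y T" and \<epsilon>: "\<epsilon> > 0"
    and tail: "[Y, F] \<in> star {[SetO A, FunO f] | A f. tail_mean A f (real k) \<le> \<epsilon>\<^sup>2 / 8}"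
  shows "\<exists>n\<ge>1. \<forall>m. [Y, F, T] \<in> star {[SetO A, FunO f, MapO t] | A f t.
             card (fluctuation_set A f t \<epsilon> n m) \<le> \<epsilon> * card A}"
    (is "\<exists>n\<ge>1. \<forall>m. _ \<in> star (?St n m)")
proof (rule ccontr)
  assume "\<not> ?thesis"
  hence "\<forall>n. \<exists>m. n \<ge> 1 \<longrightarrow> [Y, F, T] \<notin> star (?St n m)" by blast
  from choice[OF this] obtain \<Phi> where \<Phi>: "\<And>n. n \<ge> 1 \<Longrightarrow> [Y, F, T] \<notin> star (?St n (\<Phi> n))" by blast
  from metastable_ergodic_theorem[OF \<epsilon> of_nat_0_le_iff, of k \<Phi>] obtain B where
    B: "\<forall>(A :: 'a set) f t. finite A \<and> bij_betw t A A \<and> tail_mean A f (real k) \<le> \<epsilon>\<^sup>2 / 8 \<longrightarrow>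
      (\<exists>n\<in>{1..B}. card (fluctuation_set A f t \<epsilon> n (\<Phi> n)) \<le> \<epsilon> * card A)" ..
  have "[Y, F, T] \<in> star (\<Union>n\<in>{1..B}. ?St n (\<Phi> n))"
  proof (rule transfer_horn[where ps = "[({[SetO A] | A. finite A}, [0]),
        ({[SetO A, FunO f] | A f. tail_mean A f (real k) \<le> \<epsilon>\<^sup>2 / 8}, [0, 1]),
        ({[MapO t, SetO A] | t A. bij_betw t A A}, [2, 0])]" and ws = "[0, 1, 2]" and xs = "[Y, F, T]"])
    fix e :: "nat \<Rightarrow> 'a obj"
    assume "\<forall>(R, vs)\<in>set [({[SetO A] | A. finite A}, [0]),
        ({[SetO A, FunO f] | A f. tail_mean A f (real k) \<le> \<epsilon>\<^sup>2 / 8}, [0, 1]),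
        ({[MapO t, SetO A] | t A. bij_betw t A A}, [2, 0])]. map e vs \<in> R"
    then obtain A f t where e: "e 0 = SetO A" "e 1 = FunO f" "e 2 = MapO t"
      and "finite A" "tail_mean A f (real k) \<le> \<epsilon>\<^sup>2 / 8" "bij_betw t A A" by auto
    hence "\<exists>n\<in>{1..B}. card (fluctuation_set A f t \<epsilon> n (\<Phi> n)) \<le> \<epsilon> * card A"
      using B by blast
    thus "map e [0, 1, 2] \<in> (\<Union>n\<in>{1..B}. ?St n (\<Phi> n))"
      using e by simp
  qed (use Y T tail in \<open>auto simp: hyperfinite_def internal_permutation_def\<close>)
  then obtain n where "n \<in> {1..B}" "[Y, F, T] \<in> star (?St n (\<Phi> n))"
    using star_finite_UN[of "{1..B}" "[Y, F, T]" "\<lambda>n. ?St n (\<Phi> n)"] by blast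
  thus False using \<Phi>[of n] by auto
qed

lemma space_loeb: "space (loeb star Y) = elements star Y"
  unfolding loeb_def by (subst space_completion, subst space_extend_measure) auto

text \<open>
  If the premeasure on the internal sets extends to a measure, the value on a generator is the standard part
  of its relative size; otherwise \<^const>\<open>extend_measure\<close> denotes the zero measure.  The bound
  holds in both cases.
\<close>

lemma emeasure_loeb_le:
  fixes \<epsilon> :: real
  assumes Y: "hyperfinite star Y" and B: "elements star B \<subseteq> elements star Y"
    and \<epsilon>: "\<epsilon> \<ge> 0"
    and small: "[B, Y] \<in> star {[SetO D, SetO A] | D A. finite A \<and> D \<subseteq> A \<and> card D \<le> \<epsilon> * card A}"
  shows "elements star B \<in> sets (loeb star Y)" and "emeasure (loeb star Y) (elements star B) \<le> ennreal \<epsilon>"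
proof -
  define I where "I = {B \<in> internal_point_sets star. elements star B \<subseteq> elements star Y}"
  define \<mu> where "\<mu> = (\<lambda>B. ennreal (standard_part star (hdivide star (hcard star B) (hcard star Y))))"
  define M0 where "M0 = extend_measure (elements star Y) I (elements star) \<mu>"
  have loeb: "loeb star Y = completion M0" by (simp add: loeb_def M0_def I_def \<mu>_def)
  have "[B] \<in> star {[SetO A] | A. True}"
    by (rule transfer_horn[where ps = "[({[SetO D, SetO A] | D A. finite A \<and> D \<subseteq> A \<and> card D \<le> \<epsilon> * card A}, [0, 1])]"
          and ws = "[0]" and xs = "[B, Y]"]) (use small in auto)
  hence BI: "B \<in> I" using B by (simp add: I_def internal_point_sets_def)
  have Pow: "elements star ` I \<subseteq> Pow (elements star Y)" by (auto simp: I_def)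
  have B_in: "elements star B \<in> sets M0"
    using BI by (simp add: M0_def sets_extend_measure[OF Pow] sigma_sets.Basic)
  thus "elements star B \<in> sets (loeb star Y)" by (simp add: loeb)
  define b M q where "b = hcard star B" and "M = hcard star Y" and "q = hdivide star b M"
  let ?card = "{[SetO A, RealO (real (card A))] | A :: 'a set. finite A}"
  have "[B] \<in> star {[SetO A] | A. finite A}"
    by (rule transfer_horn[where ps = "[({[SetO D, SetO A] | D A. finite A \<and> D \<subseteq> A \<and> card D \<le> \<epsilon> * card A}, [0, 1])]"
          and ws = "[0]" and xs = "[B, Y]"]) (use small in \<open>auto intro: finite_subset\<close>)
  hence "[B] @ [b] \<in> star ?card"
    unfolding b_def hcard_def by (rule star_val_in[rotated 2]) auto
  hence b: "[B, b] \<in> star ?card" by simp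
  have "[Y] @ [M] \<in> star ?card"
    unfolding M_def hcard_def
    by (rule star_val_in[rotated 2]) (use Y in \<open>auto simp: hyperfinite_def\<close>)
  hence M: "[Y, M] \<in> star ?card" by simp
  have "[b, M] \<in> star {[RealO a, RealO b] | a b. True}"
    by (rule transfer_horn[where ps = "[(?card, [0, 2]), (?card, [1, 3])]"
          and ws = "[2, 3]" and xs = "[B, Y, b, M]"]) (use b M in auto)
  hence "[b, M] @ [q] \<in> star {[RealO a, RealO b, RealO (a / b)] | a b. True}"
    unfolding q_def hdivide_def by (rule star_val_in[rotated 2]) auto
  hence q: "[b, M, q] \<in> star {[RealO a, RealO b, RealO (a / b)] | a b. True}" by simp
  have quotient: "real d / real n \<le> \<epsilon>" if "real d \<le> \<epsilon> * real n" for d n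
    using that \<epsilon> by (cases "n = 0") (auto simp: divide_le_eq)
  have "[q] \<in> star {[RealO a] | a. 0 \<le> a \<and> a \<le> \<epsilon>}"
    by (rule transfer_horn[where ps = "[({[SetO D, SetO A] | D A. finite A \<and> D \<subseteq> A \<and> card D \<le> \<epsilon> * card A}, [0, 1]),
          (?card, [0, 2]), (?card, [1, 3]), ({[RealO a, RealO b, RealO (a / b)] | a b. True}, [2, 3, 4])]"
          and ws = "[4]" and xs = "[B, Y, b, M, q]"]) (use small b M q quotient in auto)
  hence "standard_part star q \<le> \<epsilon>" by (rule standard_part_le)
  hence "\<mu> B \<le> ennreal \<epsilon>" by (simp add: \<mu>_def q_def b_def M_def ennreal_leI)
  moreover have "emeasure M0 (elements star B) \<le> \<mu> B"
  proof (cases "\<exists>\<mu>'. (\<forall>i\<in>I. \<mu>' (elements star i) = \<mu> i) \<and>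
      measure_space (elements star Y) (sigma_sets (elements star Y) (elements star ` I)) \<mu>'")
    case True
    then obtain \<mu>' where "\<forall>i\<in>I. \<mu>' (elements star i) = \<mu> i"
      "measure_space (elements star Y) (sigma_sets (elements star Y) (elements star ` I)) \<mu>'" by blast
    hence "emeasure M0 (elements star B) = \<mu> B"
      by (intro emeasure_extend_measure[OF M0_def _ Pow _ _ BI, of \<mu>'])
        (auto simp: M0_def sets_extend_measure[OF Pow] measure_space_def)
    thus ?thesis by simp
  next
    case False
    hence "M0 = measure_of (elements star Y) (elements star ` I) (\<lambda>_. 0)"
      unfolding M0_def extend_measure_def by auto
    thus ?thesis by (simp add: emeasure_sigma)
  qed
  ultimately show "emeasure (loeb star Y) (elements star B) \<le> ennreal \<epsilon>"
    using B_in by (simp add: loeb)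
qed

lemma haverage_in:
  assumes T: "internal_permutation star Y T" and F: "internal_function star F"
    and K: "infinite_hnat star K" and x: "x \<in> elements star Y"
  shows "[K, F, T, x, haverage star K F T x] \<in>
     star {[RealO (real n), FunO f, MapO t, PointO a, RealO (time_average f t n a)] | n f t a. n \<ge> 1}"
proof -
  have "[K, F, T, x] \<in> star {[RealO (real n), FunO f, MapO t, PointO a] | n f t a. n \<ge> 1}"
    by (rule transfer_horn[where ps = "[({[RealO (real k)] | k. k \<ge> 1}, [0]), ({[FunO f] | f. True}, [1]),
          ({[MapO t, SetO A] | t A. bij_betw t A A}, [2, 4]), ({[PointO a, SetO A] | a A. a \<in> A}, [3, 4])]"
          and ws = "[0, 1, 2, 3]" and xs = "[K, F, T, x, Y]"])
      (use infinite_hnat_ge[OF K, of 1] F T x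
        in \<open>auto simp: internal_function_def internal_permutation_def elements_def\<close>)
  hence "[K, F, T, x] @ [haverage star K F T x] \<in>
     star {[RealO (real n), FunO f, MapO t, PointO a, RealO (time_average f t n a)] | n f t a. n \<ge> 1}"
    unfolding haverage_def by (rule star_val_in[rotated 2]) auto
  thus ?thesis by simp
qed

lemma haverage_hreal:
  assumes "internal_permutation star Y T" "internal_function star F"
    "infinite_hnat star K" "x \<in> elements star Y"
  shows "haverage star K F T x \<in> hreals star"
  unfolding hreals_def mem_Collect_eq
  by (rule transfer_horn[where ps = "[({[RealO (real n), FunO f, MapO t, PointO a, RealO (time_average f t n a)] |
          n f t a. n \<ge> 1}, [0, 1, 2, 3, 4])]" and ws = "[4]" and xs = "[K, F, T, x, haverage star K F T x]"])
    (use haverage_in[OF assms] in auto)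

text \<open>
  An infinite \<open>L\<close> exceeds the standard \<open>n\<close>, so off the fluctuation set up to \<open>N\<close> both averages are within \<open>\<delta>\<close>
  of the one at time \<open>n\<close>.
\<close>

lemma averages_close_off_fluctuations:
  assumes T: "internal_permutation star Y T" and F: "internal_function star F"
    and N: "infinite_hnat star N" and L: "infinite_hnat star L" "hless star L N"
    and x: "x \<in> elements star Y" "x \<notin> elements star D"
    and D: "[N, Y, F, T, D] \<in> star {[RealO (real m), SetO A, FunO f, MapO t,
              SetO (fluctuation_set A f t \<delta> n m)] | m A f t. True}"
    and \<delta>: "2 * \<delta> < \<epsilon>"
  shows "[haverage star L F T x, haverage star N F T x] \<in> star {[RealO a, RealO b] | a b. \<bar>a - b\<bar> < \<epsilon>}"
proof -
  let ?avg = "{[RealO (real n), FunO f, MapO t, PointO a, RealO (time_average f t n a)] |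
                 n f t (a :: 'a). n \<ge> 1}"
  let ?el = "{[PointO a, SetO A] | (a :: 'a) A. a \<in> A}"
  note average = haverage_in[OF T F _ x(1)]
  have off: "[x, D] \<in> star (- ?el)" using x by (simp add: elements_def star_Compl)
  have std: "\<bar>time_average f t l a - time_average f t m a\<bar> < \<epsilon>"
    if "a \<in> A" "a \<notin> fluctuation_set A f t \<delta> n m" "n \<le> l" "l < m" for A f t l m and a :: 'a
  proof -
    have "\<bar>time_average f t k a - time_average f t n a\<bar> \<le> \<delta>" if "k \<in> {l, m}" for k
      using \<open>a \<in> A\<close> \<open>a \<notin> _\<close> \<open>n \<le> l\<close> \<open>l < m\<close> that by (auto simp: fluctuation_set_def not_less)
    from this[of l] this[of m] show ?thesis using \<delta> by simp
  qed
  show ?thesis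
    by (rule transfer_horn[where ps = "[({[RealO (real m), SetO A, FunO f, MapO t,
              SetO (fluctuation_set A f t \<delta> n m)] | m A f t. True}, [0, 1, 2, 3, 4]),
            (?el, [5, 1]), (- ?el, [5, 4]), ({[RealO (real k)] | k. k \<ge> n}, [6]),
            ({[RealO a, RealO b] | a b. a < b}, [6, 0]), (?avg, [6, 2, 3, 5, 7]), (?avg, [0, 2, 3, 5, 8])]"
          and ws = "[7, 8]"
          and xs = "[N, Y, F, T, D, x, L, haverage star L F T x, haverage star N F T x]"])
      (use D x off infinite_hnat_ge[OF L(1), of n] L(2) average[OF L(1)] average[OF N] std
        in \<open>auto simp: elements_def hless_def\<close>)
qed

end

section \<open>Almost everywhere stability of the averages\<close>

theorem theorem3:
  fixes star :: "('a, 's) star_map" and Y T M :: 's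
  assumes "saturated_nonstandard_universe star"
    and "hyperfinite star Y"
    and "hcard star Y = M"
    and "infinite_hnat star M"
    and "internal_permutation star Y T"
  shows "\<forall>F. S_integrable star Y F \<longrightarrow>
           (\<exists>N. infinite_hnat star N \<and>
              (AE x in loeb star Y.
                 \<forall>L. infinite_hnat star L \<and> hless star L N \<longrightarrow>
                   infinitely_close star (haverage star L F T x) (haverage star N F T x)))"
proof (intro allI impI)
  fix F assume F: "S_integrable star Y F"
  have tr: "transfer_principle star" and sat: "aleph1_saturated star"
    using assms(1) by (auto simp: saturated_nonstandard_universe_def)
  have fn: "internal_function star F" using F by (simp add: S_integrable_def)
  define \<epsilon> :: "nat \<Rightarrow> real" where "\<epsilon> j = (1 / 2) ^ j" for j
  have \<epsilon>: "\<epsilon> j > 0" for j by (simp add: \<epsilon>_def)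
  have "\<forall>j. \<exists>n. \<forall>m. [Y, F, T] \<in> star {[SetO A, FunO f, MapO t] | A f t.
             card (fluctuation_set A f t (\<epsilon> j) n m) \<le> \<epsilon> j * card A}"
  proof
    fix j
    have "(\<epsilon> j)\<^sup>2 / 8 > 0" using \<epsilon>[of j] by simp
    from S_integrable_tail_small[OF tr sat assms(2) F this] obtain k :: nat where
      "[Y, F] \<in> star {[SetO A, FunO f] | A f. tail_mean A f (real k) \<le> (\<epsilon> j)\<^sup>2 / 8}" ..
    from fluctuations_stabilize[OF tr assms(2,5) \<epsilon> this]
    show "\<exists>n. \<forall>m. [Y, F, T] \<in> star {[SetO A, FunO f, MapO t] | A f t.
             card (fluctuation_set A f t (\<epsilon> j) n m) \<le> \<epsilon> j * card A}" by blast
  qed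
  from choice[OF this] obtain \<nu> where
    \<nu>: "[Y, F, T] \<in> star {[SetO A, FunO f, MapO t] | A f t.
             card (fluctuation_set A f t (\<epsilon> j) (\<nu> j) m) \<le> \<epsilon> j * card A}" for j m
    by blast
  define R where "R j = {[RealO (real m), SetO A, FunO f, MapO t] | m (A :: 'a set) f t. finite A \<and>
             card (fluctuation_set A f t (\<epsilon> j) (\<nu> j) m) \<le> \<epsilon> j * card A}" for j
  have "hreal_of star (real m) # [Y, F, T] \<in> star (R j)" for j m
    by (rule hreal_of_Cons_in_iff[OF tr],
        rule transfer_horn[OF tr, where ps = "[({[SetO A] | A. finite A}, [0]),
          ({[SetO A, FunO f, MapO t] | A f t.
             card (fluctuation_set A f t (\<epsilon> j) (\<nu> j) m) \<le> \<epsilon> j * card A}, [0, 1, 2])]"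
          and ws = "[0, 1, 2]" and xs = "[Y, F, T]"])
      (use \<nu>[of j m] assms(2) in \<open>auto simp: R_def hyperfinite_def\<close>)
  from overspill[where R = R, OF tr sat this] obtain N where
    N: "infinite_hnat star N" and NR: "[N, Y, F, T] \<in> star (R j)" for j by blast
  \<comment> \<open>The exceptional sets, as internal objects: \<open>G j\<close> is the graph of the map that assigns to a system
    satisfying \<open>R j\<close> its fluctuation set.\<close>
  define G where "G j = {[RealO (real m), SetO A, FunO f, MapO t, SetO (fluctuation_set A f t (\<epsilon> j) (\<nu> j) m)] |
             m (A :: 'a set) f t. finite A \<and>
             card (fluctuation_set A f t (\<epsilon> j) (\<nu> j) m) \<le> \<epsilon> j * card A}" for j
  have "\<forall>j. \<exists>D. [N, Y, F, T] @ [D] \<in> star (G j)"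
    by (intro allI transfer_ex[OF tr _ NR]) (auto simp: R_def G_def)
  from choice[OF this] obtain D where D: "[N, Y, F, T, D j] \<in> star (G j)" for j
    by auto
  have sub: "elements star (D j) \<subseteq> elements star Y" for j
  proof
    fix x assume "x \<in> elements star (D j)"
    thus "x \<in> elements star Y"
      unfolding elements_def mem_Collect_eq
      by (intro transfer_horn[OF tr, where ps = "[(G j, [0, 1, 2, 3, 4]), ({[PointO a, SetO A] | a A. a \<in> A}, [5, 4])]"
            and ws = "[5, 1]" and xs = "[N, Y, F, T, D j, x]"])
        (use D[of j] in \<open>auto simp: G_def fluctuation_set_def\<close>)
  qed
  have small: "[D j, Y] \<in> star {[SetO D, SetO A] | D A. finite A \<and> D \<subseteq> A \<and> card D \<le> \<epsilon> j * card A}" for j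
    by (rule transfer_horn[OF tr, where ps = "[(G j, [0, 1, 2, 3, 4])]"
          and ws = "[4, 1]" and xs = "[N, Y, F, T, D j]"])
      (use D[of j] in \<open>auto simp: G_def fluctuation_set_def\<close>)
  note loeb_D = emeasure_loeb_le[OF tr assms(2) sub less_imp_le[OF \<epsilon>] small]
  have "AE x in loeb star Y. eventually (\<lambda>j. x \<in> space (loeb star Y) - elements star (D j)) sequentially"
  proof (rule borel_cantelli_AE1)
    show "elements star (D j) \<in> sets (loeb star Y)" for j by (rule loeb_D(1))
    show "emeasure (loeb star Y) (elements star (D j)) < \<infinity>" for j
      using loeb_D(2)[of j] by (simp add: le_less_trans)
    have summable_\<epsilon>: "summable \<epsilon>" unfolding \<epsilon>_def by (rule summable_geometric) simp
    have "measure (loeb star Y) (elements star (D j)) \<le> \<epsilon> j" for j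
      using loeb_D(2)[of j] \<epsilon>[of j] by (simp add: measure_def enn2real_leI)
    thus "summable (\<lambda>j. measure (loeb star Y) (elements star (D j)))"
      by (intro summable_comparison_test'[OF summable_\<epsilon>, where N = 0]) simp
  qed
  hence "AE x in loeb star Y. \<forall>L. infinite_hnat star L \<and> hless star L N \<longrightarrow>
           infinitely_close star (haverage star L F T x) (haverage star N F T x)"
  proof (rule eventually_mono, intro allI impI, elim conjE)
    fix x L
    assume ev: "eventually (\<lambda>j. x \<in> space (loeb star Y) - elements star (D j)) sequentially"
      and L: "infinite_hnat star L" "hless star L N"
    have x: "x \<in> elements star Y"
      using eventually_happens[OF ev] by (simp add: space_loeb[OF tr])
    show "infinitely_close star (haverage star L F T x) (haverage star N F T x)"
      unfolding infinitely_close_iff[OF tr]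
    proof (intro conjI allI impI haverage_hreal[OF tr assms(5) fn _ x] L N)
      fix \<eta> :: real assume "\<eta> > 0"
      have "(\<lambda>j. 2 * \<epsilon> j) \<longlonglongrightarrow> 2 * 0"
        unfolding \<epsilon>_def by (intro tendsto_mult tendsto_const LIMSEQ_realpow_zero) auto
      hence "eventually (\<lambda>j. 2 * \<epsilon> j < \<eta>) sequentially"
        using \<open>\<eta> > 0\<close> by (intro order_tendstoD) auto
      from eventually_happens[OF eventually_conj[OF ev this]] obtain j where
        j: "x \<notin> elements star (D j)" "2 * \<epsilon> j < \<eta>" by auto
      have "[N, Y, F, T, D j] \<in> star {[RealO (real m), SetO A, FunO f, MapO t,
              SetO (fluctuation_set A f t (\<epsilon> j) (\<nu> j) m)] | m A f t. True}"
        by (rule star_mono[OF tr D[of j]]) (auto simp: G_def)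
      from averages_close_off_fluctuations[OF tr assms(5) fn N L x j(1) this j(2)]
      show "[haverage star L F T x, haverage star N F T x] \<in> star {[RealO a, RealO b] | a b. \<bar>a - b\<bar> < \<eta>}" .
    qed
  qed
  thus "\<exists>N. infinite_hnat star N \<and>
              (AE x in loeb star Y.
                 \<forall>L. infinite_hnat star L \<and> hless star L N \<longrightarrow>
                   infinitely_close star (haverage star L F T x) (haverage star N F T x))"
    using N by blast
qed

end
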